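(* Let $n\geqslant 1$, $N=\{1,\dots,n\}$, and let $\nu$ be a game on $N$. Let $X_1,\dots,X_n$ be i.i.d. real random variables with continuous cumulative distribution function $F:\mathbb{R}\to\mathbb{R}$ admitting a probability density function $f:\mathbb{R}\to\mathbb{R}$, and let $X_{1:n}\leqslant\cdots\leqslant X_{n:n}$ be the corresponding order statistics. Let $F_\nu$ be the cumulative distribution function of $Y_\nu:=C_\nu(X_1,\dots,X_n)$ and, for $\sigma\in\mathfrak{S}_n$, let $F_\nu^\sigma$ be the cumulative distribution function of $Y_\nu^\sigma:=\sum_{i=1}^n p_i^{\nu,\sigma}\,X_{n-i+1:n}$. Then for every $y\in\mathbb{R}$, $$F_\nu(y)=\frac{1}{n!}\sum_{\sigma\in\mathfrak{S}_n}F_\nu^\sigma(y).$$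
   Context: $\mathfrak{S}_n$ denotes the set of permutations of $N=\{1,\dots,n\}$. A game on $N$ is a set function $\nu:2^N\to[0,1]$ with $\nu(\varnothing)=0$ (no monotonicity is required). For $\sigma\in\mathfrak{S}_n$ and $i=0,\dots,n$, let $\nu_i^\sigma:=\nu(\{\sigma(1),\dots,\sigma(i)\})$ (so $\nu_0^\sigma=0$), and for $i\in N$ let $p_i^{\nu,\sigma}:=\nu_i^\sigma-\nu_{i-1}^\sigma$. The discrete Choquet integral of $\mathbf{x}\in\mathbb{R}^n$ with respect to $\nu$ is $C_\nu(\mathbf{x}):=\sum_{i=1}^n p_i^{\nu,\sigma}\,x_{\sigma(i)}$, where $\sigma\in\mathfrak{S}_n$ is any permutation such that $x_{\sigma(1)}\geqslant\cdots\geqslant x_{\sigma(n)}$ (the value does not depend on the choice of such $\sigma$). The order statistics $X_{1:n}\leqslant\cdots\leqslant X_{n:n}$ are the values $X_1,\dots,X_n$ rearranged in nondecreasing order. *)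

theory Defs
  imports "HOL-Probability.Probability" "HOL-Combinatorics.Permutations"
begin

text \<open>Values of \<^term>\<open>\<nu>\<close> outside the subsets of \<open>{1..n}\<close> are junk and are never used.\<close>

definition game :: "nat \<Rightarrow> (nat set \<Rightarrow> real) \<Rightarrow> bool" where
  "game n \<nu> \<longleftrightarrow> \<nu> {} = 0 \<and> (\<forall>S\<subseteq>{1..n}. \<nu> S \<in> {0..1})"

definition chain_val :: "(nat set \<Rightarrow> real) \<Rightarrow> (nat \<Rightarrow> nat) \<Rightarrow> nat \<Rightarrow> real" where
  "chain_val \<nu> \<sigma> i = \<nu> (\<sigma> ` {1..i})"

text \<open>Meant for \<open>i \<ge> 1\<close>.\<close>

definition chain_inc :: "(nat set \<Rightarrow> real) \<Rightarrow> (nat \<Rightarrow> nat) \<Rightarrow> nat \<Rightarrow> real" where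
  "chain_inc \<nu> \<sigma> i = chain_val \<nu> \<sigma> i - chain_val \<nu> \<sigma> (i - 1)"

text \<open>A vector in \<open>\<real>\<^sup>n\<close> is a function \<open>nat \<Rightarrow> real\<close> of which only the values on \<open>{1..n}\<close> matter.\<close>

definition sorting_perm :: "nat \<Rightarrow> (nat \<Rightarrow> real) \<Rightarrow> (nat \<Rightarrow> nat) \<Rightarrow> bool" where
  "sorting_perm n x \<sigma> \<longleftrightarrow> \<sigma> permutes {1..n} \<and> antimono_on {1..n} (\<lambda>i. x (\<sigma> i))"

text \<open>The choice below is always possible (\<open>sorting_perm_exists\<close>), and the value
  does not depend on it (\<open>choquet_eq\<close>).\<close>

definition choquet :: "nat \<Rightarrow> (nat set \<Rightarrow> real) \<Rightarrow> (nat \<Rightarrow> real) \<Rightarrow> real" where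
  "choquet n \<nu> x =
     (let \<sigma> = (SOME \<sigma>. sorting_perm n x \<sigma>) in \<Sum>i=1..n. chain_inc \<nu> \<sigma> i * x (\<sigma> i))"

text \<open>The \<open>k\<close>-th smallest of \<open>x 1, \<dots>, x n\<close>, for \<open>1 \<le> k \<le> n\<close>.\<close>

definition order_stat :: "nat \<Rightarrow> nat \<Rightarrow> (nat \<Rightarrow> real) \<Rightarrow> real" where
  "order_stat n k x = sort (map x [1..<Suc n]) ! (k - 1)"

lemma sorting_perm_order_stat:
  assumes "sorting_perm n x \<sigma>" "i \<in> {1..n}"
  shows "x (\<sigma> i) = order_stat n (n - i + 1) x"
proof -
  have perm: "\<sigma> permutes {1..n}" and anti: "antimono_on {1..n} (\<lambda>i. x (\<sigma> i))"
    using assms(1) by (auto simp: sorting_perm_def)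
  let ?l = "map (\<lambda>i. x (\<sigma> i)) [1..<Suc n]"
  have "mset (map \<sigma> [1..<Suc n]) = mset [1..<Suc n]"
  proof -
    have "mset (map \<sigma> [1..<Suc n]) = image_mset \<sigma> (mset_set {1..n})"
      by (simp add: atLeastLessThanSuc_atLeastAtMost del: upt_Suc)
    also have "\<dots> = mset_set {1..n}"
      using perm by (simp add: image_mset_mset_set permutes_inj_on permutes_image)
    finally show ?thesis
      by (simp add: atLeastLessThanSuc_atLeastAtMost del: upt_Suc)
  qed
  then have "mset (map x (map \<sigma> [1..<Suc n])) = mset (map x [1..<Suc n])"
    by (simp only: mset_map)
  then have "mset (rev ?l) = mset (map x [1..<Suc n])"
    by (simp only: map_map o_def mset_rev)
  moreover have "sorted (rev ?l)"
    unfolding sorted_rev_iff_nth_mono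
    using anti by (auto simp: monotone_on_def simp del: upt_Suc)
  ultimately have "sort (map x [1..<Suc n]) = rev ?l"
    by (rule properties_for_sort)
  then show ?thesis
    using assms(2) unfolding order_stat_def by (auto simp: rev_nth simp del: upt_Suc)
qed

lemma sorting_perm_exists: "\<exists>\<sigma>. sorting_perm n x \<sigma>"
proof -
  let ?l = "rev (sort_key x [1..<Suc n])"
  have len: "length ?l = n" by (simp del: upt_Suc)
  have "distinct ?l" and set: "set ?l = {1..n}"
    by (auto simp del: upt_Suc)
  then have "bij_betw (\<lambda>i. ?l ! i) {..<n} {1..n}"
    using bij_betw_nth[of ?l "{..<n}" "{1..n}"] len by simp
  moreover have "bij_betw (\<lambda>i. i - 1) {1..n} {..<n}"
    by (rule bij_betw_byWitness[where f' = Suc]) auto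
  ultimately have bij: "bij_betw (\<lambda>i. ?l ! (i - 1)) {1..n} {1..n}"
    using bij_betw_trans[of "\<lambda>i. i - 1" "{1..n}" "{..<n}" "\<lambda>i. ?l ! i"] by (simp add: o_def)
  define \<sigma> where "\<sigma> i = (if i \<in> {1..n} then ?l ! (i - 1) else i)" for i
  have "bij_betw \<sigma> {1..n} {1..n}"
    using bij by (rule bij_betw_cong[THEN iffD1, rotated]) (simp add: \<sigma>_def)
  then have "\<sigma> permutes {1..n}"
    by (rule bij_imp_permutes) (simp only: \<sigma>_def if_False)
  moreover have "x (?l ! j) \<le> x (?l ! i)" if "i \<le> j" "j < n" for i j
  proof -
    have "sorted (rev (map x ?l))"
      by (simp add: rev_map del: upt_Suc)
    from sorted_rev_nth_mono[OF this, of i j] show ?thesis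
      using that len by simp
  qed
  then have "antimono_on {1..n} (\<lambda>i. x (\<sigma> i))"
    by (auto simp: monotone_on_def \<sigma>_def)
  ultimately show ?thesis unfolding sorting_perm_def by blast
qed

lemma sorting_perm_image:
  assumes "sorting_perm n x \<sigma>" "1 \<le> i" "i < n" "x (\<sigma> i) \<noteq> x (\<sigma> (Suc i))"
  shows "\<sigma> ` {1..i} = {j\<in>{1..n}. x j \<ge> x (\<sigma> i)}"
proof (rule set_eqI)
  fix j
  have perm: "\<sigma> permutes {1..n}" and
    anti: "\<And>a b. 1 \<le> a \<Longrightarrow> a \<le> b \<Longrightarrow> b \<le> n \<Longrightarrow> x (\<sigma> b) \<le> x (\<sigma> a)"
    using assms(1) by (auto simp: sorting_perm_def monotone_on_def)
  have lt: "x (\<sigma> (Suc i)) < x (\<sigma> i)"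
    using anti[of i "Suc i"] assms by simp
  show "j \<in> \<sigma> ` {1..i} \<longleftrightarrow> j \<in> {j\<in>{1..n}. x j \<ge> x (\<sigma> i)}"
  proof
    assume "j \<in> \<sigma> ` {1..i}"
    then obtain k where k: "j = \<sigma> k" "1 \<le> k" "k \<le> i" by auto
    then show "j \<in> {j\<in>{1..n}. x j \<ge> x (\<sigma> i)}"
      using anti[of k i] assms(3) permutes_in_image[OF perm, of k] by auto
  next
    assume j: "j \<in> {j\<in>{1..n}. x j \<ge> x (\<sigma> i)}"
    then have "j \<in> \<sigma> ` {1..n}" using permutes_image[OF perm] by simp
    then obtain k where k: "j = \<sigma> k" "1 \<le> k" "k \<le> n" by auto
    have "k \<le> i"
    proof (rule ccontr)
      assume "\<not> k \<le> i"
      then show False using anti[of "Suc i" k] k j lt by auto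
    qed
    then show "j \<in> \<sigma> ` {1..i}" using k by auto
  qed
qed

lemma sum_by_parts:
  fixes a y :: "nat \<Rightarrow> real"
  assumes "a 0 = 0"
  shows "(\<Sum>i=1..n. (a i - a (i - 1)) * y i) =
    (\<Sum>i=1..<n. a i * (y i - y (Suc i))) + a n * y n"
proof (induction n)
  case (Suc n)
  show ?case
  proof (cases n)
    case (Suc m)
    have "{1..<Suc n} = insert n {1..<n}" using Suc by auto
    then show ?thesis using Suc.IH by (simp add: algebra_simps)
  qed (simp add: assms)
qed (simp add: assms)

lemma choquet_eq:
  assumes "\<nu> {} = 0" "sorting_perm n x \<sigma>"
  shows "choquet n \<nu> x = (\<Sum>i=1..n. chain_inc \<nu> \<sigma> i * x (\<sigma> i))"
proof -
  define y where "y i = order_stat n (n - i + 1) x" for i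
  have canonical: "(\<Sum>i=1..n. chain_inc \<nu> \<tau> i * x (\<tau> i)) =
      (\<Sum>i=1..<n. \<nu> {j\<in>{1..n}. x j \<ge> y i} * (y i - y (Suc i))) + \<nu> {1..n} * y n"
    if \<tau>: "sorting_perm n x \<tau>" for \<tau>
  proof -
    have xy: "x (\<tau> i) = y i" if "i \<in> {1..n}" for i
      using sorting_perm_order_stat[OF \<tau> that] by (simp add: y_def)
    have "(\<Sum>i=1..n. chain_inc \<nu> \<tau> i * x (\<tau> i)) =
        (\<Sum>i=1..n. (chain_val \<nu> \<tau> i - chain_val \<nu> \<tau> (i - 1)) * y i)"
      by (intro sum.cong) (auto simp: chain_inc_def xy)
    also have "\<dots> = (\<Sum>i=1..<n. chain_val \<nu> \<tau> i * (y i - y (Suc i))) + chain_val \<nu> \<tau> n * y n"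
      by (rule sum_by_parts) (simp add: chain_val_def assms)
    also have "(\<Sum>i=1..<n. chain_val \<nu> \<tau> i * (y i - y (Suc i))) =
        (\<Sum>i=1..<n. \<nu> {j\<in>{1..n}. x j \<ge> y i} * (y i - y (Suc i)))"
    proof (intro sum.cong refl)
      fix i assume i: "i \<in> {1..<n}"
      show "chain_val \<nu> \<tau> i * (y i - y (Suc i)) =
          \<nu> {j\<in>{1..n}. x j \<ge> y i} * (y i - y (Suc i))"
      proof (cases "y i = y (Suc i)")
        case False
        then show ?thesis
          using sorting_perm_image[OF \<tau>, of i] i xy by (simp add: chain_val_def)
      qed simp
    qed
    also have "chain_val \<nu> \<tau> n = \<nu> {1..n}"
      using \<tau> by (simp add: chain_val_def sorting_perm_def permutes_image)
    finally show ?thesis .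
  qed
  have "sorting_perm n x (SOME \<sigma>. sorting_perm n x \<sigma>)"
    using sorting_perm_exists by (rule someI_ex)
  from canonical[OF this] canonical[OF assms(2)] show ?thesis
    by (simp add: choquet_def Let_def)
qed

end

theory Submission
  imports Defs
begin

text \<open>
  A random vector with i.i.d. components is exchangeable. Condition on the permutation sorting the
  vector: given that it is \<open>\<tau>\<close>, the Choquet integral is \<open>Y\<^sub>\<nu>\<^sup>\<tau>\<close>. Each \<open>Y\<^sub>\<nu>\<^sup>\<sigma>\<close> is a symmetric function
  of the vector, so its law given that \<open>\<tau>\<close> sorts the vector does not depend on \<open>\<tau>\<close>, while every \<open>\<tau>\<close>
  has the same probability \<open>1 / n!\<close>. Ties are dealt with by choosing uniformly among the permutations
  that sort the vector.
\<close>

section \<open>Weights of sorting permutations\<close>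

text \<open>The probability that a permutation drawn uniformly from those sorting \<open>x\<close>
  is \<open>\<tau>\<close>; the draw itself is never modelled as a random variable.\<close>

definition sort_weight :: "nat \<Rightarrow> (nat \<Rightarrow> nat) \<Rightarrow> (nat \<Rightarrow> real) \<Rightarrow> real" where
  "sort_weight n \<tau> x = of_bool (sorting_perm n x \<tau>) / card {\<tau>'. sorting_perm n x \<tau>'}"

lemma sorting_perm_permutes: "sorting_perm n x \<tau> \<Longrightarrow> \<tau> permutes {1..n}"
  by (simp add: sorting_perm_def)

lemma finite_sorting_perms: "finite {\<tau>. sorting_perm n x \<tau>}"
  by (rule finite_subset[OF _ finite_permutations[of "{1..n}"]]) (auto dest: sorting_perm_permutes)

lemma sum_sort_weight: "(\<Sum>\<tau> | \<tau> permutes {1..n}. sort_weight n \<tau> x) = 1"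
proof -
  have "(\<Sum>\<tau> | \<tau> permutes {1..n}. sort_weight n \<tau> x) = (\<Sum>\<tau> | sorting_perm n x \<tau>. sort_weight n \<tau> x)"
    by (rule sum.mono_neutral_right)
      (auto simp: sort_weight_def finite_permutations dest: sorting_perm_permutes)
  \<comment> \<open>Some permutation sorts \<open>x\<close>, so the common denominator is
    nonzero.\<close>
  also have "\<dots> = 1"
    using sorting_perm_exists[of n x] finite_sorting_perms[of n x] by (simp add: sort_weight_def)
  finally show ?thesis .
qed

text \<open>The weights vanish off the sorting permutations and sum to one. This turns a quantity
  read off an arbitrary sorting permutation into a sum over a fixed finite set, through which
  measurability and expectation pass.\<close>

lemma sort_weight_decompose:
  assumes "\<And>\<tau>. sorting_perm n x \<tau> \<Longrightarrow> h \<tau> = c"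
  shows "c = (\<Sum>\<tau> | \<tau> permutes {1..n}. sort_weight n \<tau> x * h \<tau>)"
proof -
  have "(\<Sum>\<tau> | \<tau> permutes {1..n}. sort_weight n \<tau> x * h \<tau>) =
      (\<Sum>\<tau> | \<tau> permutes {1..n}. sort_weight n \<tau> x * c)"
    by (intro sum.cong refl) (auto simp: sort_weight_def assms)
  also have "\<dots> = c"
    by (simp only: sum_distrib_right[symmetric] sum_sort_weight mult_1)
  finally show ?thesis by simp
qed

section \<open>Restriction to \<open>{1..n}\<close> and permutation of coordinates\<close>

text \<open>Tuples in the product space over \<open>{1..n}\<close> are \<open>undefined\<close> off
  the index set; \<open>sort_weight_cong\<close> and \<open>order_stat_cong\<close> likewise make
  values there irrelevant.\<close>

lemma sorting_perm_cong:
  assumes "\<And>i. i \<in> {1..n} \<Longrightarrow> x i = y i"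
  shows "sorting_perm n x \<tau> \<longleftrightarrow> sorting_perm n y \<tau>"
proof (cases "\<tau> permutes {1..n}")
  case True
  then have "x (\<tau> i) = y (\<tau> i)" if "i \<in> {1..n}" for i
    using that by (intro assms) (simp only: permutes_in_image)
  then show ?thesis by (auto simp: sorting_perm_def monotone_on_def)
qed (simp add: sorting_perm_def)

lemma sort_weight_cong:
  "(\<And>i. i \<in> {1..n} \<Longrightarrow> x i = y i) \<Longrightarrow> sort_weight n \<tau> x = sort_weight n \<tau> y"
  using sorting_perm_cong[of n x y] by (simp add: sort_weight_def)

lemma order_stat_cong:
  assumes "\<And>i. i \<in> {1..n} \<Longrightarrow> x i = y i"
  shows "order_stat n k x = order_stat n k y"
proof -
  have "map x [1..<Suc n] = map y [1..<Suc n]"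
    by (rule map_cong) (auto simp: assms simp del: upt_Suc)
  then show ?thesis by (simp only: order_stat_def)
qed

lemma sorting_perm_compose:
  assumes "\<pi> permutes {1..n}"
  shows "sorting_perm n (x \<circ> \<pi>) \<tau> \<longleftrightarrow> sorting_perm n x (\<pi> \<circ> \<tau>)"
proof -
  have "\<tau> permutes {1..n}" if "\<pi> \<circ> \<tau> permutes {1..n}"
    using permutes_compose[OF that permutes_inv[OF assms]] permutes_inv_o(2)[OF assms]
    by (simp add: comp_assoc[symmetric])
  then have "\<pi> \<circ> \<tau> permutes {1..n} \<longleftrightarrow> \<tau> permutes {1..n}"
    using permutes_compose assms by blast
  then show ?thesis by (simp add: sorting_perm_def)
qed

text \<open>Left composition with \<open>\<pi>\<close> maps the permutations sorting
  \<open>x \<circ> \<pi>\<close> bijectively onto those sorting \<open>x\<close>, so the two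
  denominators agree.\<close>

lemma sort_weight_compose:
  assumes "\<pi> permutes {1..n}"
  shows "sort_weight n \<tau> (x \<circ> \<pi>) = sort_weight n (\<pi> \<circ> \<tau>) x"
proof -
  have "\<rho> \<in> (\<circ>) \<pi> ` {\<tau>. sorting_perm n x (\<pi> \<circ> \<tau>)}" if "sorting_perm n x \<rho>" for \<rho>
    using that permutes_inv_o(1)[OF assms]
    by (intro image_eqI[of _ _ "inv \<pi> \<circ> \<rho>"]) (simp_all add: comp_assoc[symmetric])
  then have "bij_betw ((\<circ>) \<pi>) {\<tau>. sorting_perm n x (\<pi> \<circ> \<tau>)} {\<tau>. sorting_perm n x \<tau>}"
    using permutes_inj[OF assms] by (auto simp: bij_betw_def inj_on_def fun.inj_map_strong fun_eq_iff inj_def)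
  from bij_betw_same_card[OF this] show ?thesis
    by (simp add: sort_weight_def sorting_perm_compose[OF assms])
qed

text \<open>If \<open>\<tau>\<close> sorts \<open>x \<circ> \<pi>\<close>, then
  \<open>\<pi> \<circ> \<tau>\<close> sorts \<open>x\<close>, and both sides are the entry that
  these put at position \<open>n - k + 1\<close>, counted from the largest.\<close>

lemma order_stat_compose:
  assumes "\<pi> permutes {1..n}" "k \<in> {1..n}"
  shows "order_stat n k (x \<circ> \<pi>) = order_stat n k x"
proof -
  obtain \<tau> where \<tau>: "sorting_perm n (x \<circ> \<pi>) \<tau>"
    using sorting_perm_exists by blast
  show ?thesis
    using sorting_perm_order_stat[OF \<tau>, of "n - k + 1"] assms
      sorting_perm_order_stat[OF \<tau>[unfolded sorting_perm_compose[OF assms(1)]], of "n - k + 1"]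
    by auto
qed

section \<open>Measurability\<close>

lemma borel_measurable_sort_weight:
  assumes [measurable]: "\<And>i. i \<in> {1..n} \<Longrightarrow> X i \<in> borel_measurable M"
  shows "(\<lambda>\<omega>. sort_weight n \<tau> (\<lambda>i. X i \<omega>)) \<in> borel_measurable M"
proof -
  have sorting: "(\<lambda>\<omega>. of_bool (sorting_perm n (\<lambda>i. X i \<omega>) \<sigma>) :: real) \<in> borel_measurable M" for \<sigma>
  proof (cases "\<sigma> permutes {1..n}")
    case True
    then have [measurable]: "X (\<sigma> i) \<in> borel_measurable M" if "i \<in> {1..n}" for i
      using that by (intro assms) (simp only: permutes_in_image)
    have "Measurable.pred M (\<lambda>\<omega>. \<forall>i\<in>{1..n}. \<forall>j\<in>{1..n}. i \<le> j \<longrightarrow> X (\<sigma> j) \<omega> \<le> X (\<sigma> i) \<omega>)"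
      by measurable
    moreover have "sorting_perm n (\<lambda>i. X i \<omega>) \<sigma> \<longleftrightarrow>
        (\<forall>i\<in>{1..n}. \<forall>j\<in>{1..n}. i \<le> j \<longrightarrow> X (\<sigma> j) \<omega> \<le> X (\<sigma> i) \<omega>)" for \<omega>
      using True by (auto simp: sorting_perm_def monotone_on_def)
    ultimately show ?thesis by (simp only: of_bool_def) measurable
  qed (simp add: sorting_perm_def)
  \<comment> \<open>The denominator becomes a sum of indicators over a fixed index set, hence
    measurable.\<close>
  have "real (card {\<sigma>. sorting_perm n x \<sigma>}) =
      (\<Sum>\<sigma> | \<sigma> permutes {1..n}. of_bool (sorting_perm n x \<sigma>))" for x
    by (subst sum_of_bool_eq)
      (auto simp: finite_permutations Int_def sorting_perm_def intro!: arg_cong[where f = card])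
  then show ?thesis
    unfolding sort_weight_def by (simp only:) (intro borel_measurable_divide borel_measurable_sum sorting)
qed

text \<open>Decomposing along sorting permutations expresses the order statistic by weights and
  coordinates, with no recourse to \<open>sort\<close> on lists.\<close>

lemma borel_measurable_order_stat:
  assumes X: "\<And>i. i \<in> {1..n} \<Longrightarrow> X i \<in> borel_measurable M" and k: "k \<in> {1..n}"
  shows "(\<lambda>\<omega>. order_stat n k (\<lambda>i. X i \<omega>)) \<in> borel_measurable M"
proof -
  have "order_stat n k x = (\<Sum>\<tau> | \<tau> permutes {1..n}. sort_weight n \<tau> x * x (\<tau> (n - k + 1)))" for x
  proof (rule sort_weight_decompose)
    fix \<tau> assume "sorting_perm n x \<tau>"
    from sorting_perm_order_stat[OF this, of "n - k + 1"] k
    show "x (\<tau> (n - k + 1)) = order_stat n k x" by (cases k) auto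
  qed
  moreover have "X (\<tau> (n - k + 1)) \<in> borel_measurable M" if "\<tau> permutes {1..n}" for \<tau>
    by (intro X permutes_in_image[OF that, THEN iffD2]) (use k in auto)
  ultimately show ?thesis
    by (simp only:) (intro borel_measurable_sum borel_measurable_times borel_measurable_sort_weight;
        simp only: mem_Collect_eq X)
qed

text \<open>The chosen sorting permutation varies with \<open>\<omega>\<close>; the decomposition
  removes the choice operator.\<close>

lemma borel_measurable_choquet:
  assumes X: "\<And>i. i \<in> {1..n} \<Longrightarrow> X i \<in> borel_measurable M" and "\<nu> {} = 0"
  shows "(\<lambda>\<omega>. choquet n \<nu> (\<lambda>i. X i \<omega>)) \<in> borel_measurable M"
proof -
  have "choquet n \<nu> x = (\<Sum>\<tau> | \<tau> permutes {1..n}. sort_weight n \<tau> x *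
      (\<Sum>i=1..n. chain_inc \<nu> \<tau> i * x (\<tau> i)))" for x
    by (intro sort_weight_decompose) (simp add: choquet_eq assms(2))
  moreover have "X (\<tau> i) \<in> borel_measurable M" if "\<tau> permutes {1..n}" "i \<in> {1..n}" for \<tau> i
    using that by (intro X) (simp only: permutes_in_image)
  ultimately show ?thesis
    by (simp only:) (intro borel_measurable_sum borel_measurable_times borel_measurable_const
        borel_measurable_sort_weight; simp only: mem_Collect_eq X)
qed

section \<open>Exchangeability and distribution functions\<close>

text \<open>The joint law is a power of the single law \<open>D\<close>, and permuting coordinates
  preserves such a power.\<close>

lemma (in prob_space) iid_exchangeable:
  assumes "indep_vars (\<lambda>_. N) X I" "I \<noteq> {}" "\<pi> permutes I"
    and "\<And>i. i \<in> I \<Longrightarrow> distr M N (X i) = D"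
  shows "distr M (Pi\<^sub>M I (\<lambda>_. N)) (\<lambda>\<omega>. \<lambda>i\<in>I. X (\<pi> i) \<omega>) =
    distr M (Pi\<^sub>M I (\<lambda>_. N)) (\<lambda>\<omega>. \<lambda>i\<in>I. X i \<omega>)"
proof -
  let ?N = "Pi\<^sub>M I (\<lambda>_. N)" and ?D = "Pi\<^sub>M I (\<lambda>_. D)"
  have \<pi>: "\<pi> i \<in> I" if "i \<in> I" for i
    using that assms(3) by (simp add: permutes_in_image)
  have rv [measurable]: "random_variable N (X i)" if "i \<in> I" for i
    using assms(1) that by (auto simp: indep_vars_def)
  obtain i where "i \<in> I"
    using assms(2) by blast
  then have D: "prob_space D" and sets_D [measurable_cong]: "sets D = sets N"
    using prob_space_distr[OF rv, of i] assms(4)[of i] by auto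
  have sets: "sets ?D = sets ?N"
    by (intro sets_PiM_cong refl sets_D)
  have "distr M ?N (\<lambda>\<omega>. \<lambda>i\<in>I. X i \<omega>) = Pi\<^sub>M I (\<lambda>i. distr M N (X i))"
    using assms(1,2) rv by (subst (asm) indep_vars_iff_distr_eq_PiM') auto
  also have "\<dots> = ?D"
    by (intro PiM_cong refl assms(4))
  finally have law: "distr M ?N (\<lambda>\<omega>. \<lambda>i\<in>I. X i \<omega>) = ?D" .
  have reindex [measurable]: "(\<lambda>u. \<lambda>i\<in>I. u (\<pi> i)) \<in> ?N \<rightarrow>\<^sub>M ?N"
    using \<pi> by (intro measurable_restrict measurable_component_singleton)
  have "distr M ?N (\<lambda>\<omega>. \<lambda>i\<in>I. X (\<pi> i) \<omega>) =
      distr (distr M ?N (\<lambda>\<omega>. \<lambda>i\<in>I. X i \<omega>)) ?N (\<lambda>u. \<lambda>i\<in>I. u (\<pi> i))"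
    by (subst distr_distr) (auto simp: \<pi> o_def cong: restrict_cong)
  \<comment> \<open>\<open>distr_PiM_reindex\<close> wants the product of \<open>D\<close> as
    target; it has the same sets as \<open>?N\<close>.\<close>
  also have "\<dots> = distr ?D ?D (\<lambda>u. \<lambda>i\<in>I. u (\<pi> i))"
    unfolding law by (intro distr_cong refl sets[symmetric])
  also have "\<dots> = ?D"
    using assms(3) D \<pi> by (intro distr_PiM_reindex) (auto simp: permutes_inj_on)
  finally show ?thesis by (simp only: law)
qed

text \<open>Makes linearity of expectation applicable to decompositions of indicators.\<close>

lemma (in prob_space) cdf_distr_eq_expectation:
  assumes [measurable]: "random_variable borel Y"
  shows "cdf (distr M borel Y) y = expectation (\<lambda>\<omega>. indicator {..y} (Y \<omega>))"
proof -
  have "expectation (\<lambda>\<omega>. indicator {..y} (Y \<omega>) :: real) = (\<integral>t. indicator {..y} t \<partial>distr M borel Y)"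
    by (rule integral_distr[symmetric]) auto
  then show ?thesis by (simp add: cdf_def)
qed

theorem corollary3:
  fixes n :: nat
    and \<nu> :: "nat set \<Rightarrow> real"
    and M :: "'a measure"
    and X :: "nat \<Rightarrow> 'a \<Rightarrow> real"
    and F f :: "real \<Rightarrow> real"
  assumes "n \<ge> 1"
    and "game n \<nu>"
    and "prob_space M"
    and "prob_space.indep_vars M (\<lambda>_. borel) X {1..n}"
    and "\<And>i x. i \<in> {1..n} \<Longrightarrow> cdf (distr M borel (X i)) x = F x"
    and "continuous_on UNIV F"
    and "\<And>x. f x \<ge> 0"
    and "\<And>i. i \<in> {1..n} \<Longrightarrow> distributed M lborel (X i) (\<lambda>x. ennreal (f x))"
  shows "\<forall>y. cdf (distr M borel (\<lambda>\<omega>. choquet n \<nu> (\<lambda>i. X i \<omega>))) y =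
    1 / fact n * (\<Sum>\<sigma> | \<sigma> permutes {1..n}.
      cdf (distr M borel (\<lambda>\<omega>. \<Sum>i=1..n. chain_inc \<nu> \<sigma> i *
        order_stat n (n - i + 1) (\<lambda>i. X i \<omega>))) y)"
proof
  fix y
  interpret prob_space M by fact
  define Z where "Z \<sigma> x = (\<Sum>i=1..n. chain_inc \<nu> \<sigma> i * order_stat n (n - i + 1) x)" for \<sigma> x
  \<comment> \<open>Its expectation at the random vector is the probability that
    \<open>Y\<^sub>\<nu>\<^sup>\<sigma>\<close> is at most \<open>y\<close> while
    \<open>\<tau>\<close> is the permutation drawn.\<close>
  define \<phi> where "\<phi> \<tau> \<sigma> x = sort_weight n \<tau> x * indicator {..y} (Z \<sigma> x)" for \<tau> \<sigma> x
  define P where "P = {\<sigma>. \<sigma> permutes {1..n}}"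
  define x where "x = (\<lambda>\<omega> i. X i \<omega>)"
  let ?N = "Pi\<^sub>M {1..n} (\<lambda>_. borel :: real measure)"
  have X: "random_variable borel (X i)" if "i \<in> {1..n}" for i
    using assms(4) that by (auto simp: indep_vars_def)
  have \<nu>0: "\<nu> {} = 0" using assms(2) by (simp add: game_def)

  have Z_meas: "(\<lambda>\<omega>. Z \<sigma> (\<lambda>i. U i \<omega>)) \<in> borel_measurable K"
    if "\<And>i. i \<in> {1..n} \<Longrightarrow> U i \<in> borel_measurable K"
    for \<sigma> and U :: "nat \<Rightarrow> 'b \<Rightarrow> real" and K
    unfolding Z_def using that
    by (intro borel_measurable_sum borel_measurable_times borel_measurable_order_stat) auto
  \<comment> \<open>Needed on two spaces: for the variables \<open>X i\<close> on \<open>M\<close>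
    and for the coordinate maps on \<open>?N\<close>.\<close>
  have \<phi>_meas: "(\<lambda>\<omega>. \<phi> \<tau> \<sigma> (\<lambda>i. U i \<omega>)) \<in> borel_measurable K"
    if "\<And>i. i \<in> {1..n} \<Longrightarrow> U i \<in> borel_measurable K"
    for \<tau> \<sigma> and U :: "nat \<Rightarrow> 'b \<Rightarrow> real" and K
  proof -
    note [measurable] = Z_meas[OF that] borel_measurable_sort_weight[OF that]
    show ?thesis unfolding \<phi>_def by measurable
  qed
  have ZX_meas: "random_variable borel (\<lambda>\<omega>. Z \<sigma> (x \<omega>))" for \<sigma>
    unfolding x_def by (rule Z_meas) (rule X)
  have sw_bounds: "0 \<le> sort_weight n \<tau> x \<and> sort_weight n \<tau> x \<le> 1" for \<tau> x
    by (cases "card {\<tau>'. sorting_perm n x \<tau>'}") (auto simp: sort_weight_def divide_simps)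
  have \<phi>_int: "integrable M (\<lambda>\<omega>. \<phi> \<tau> \<sigma> (x \<omega>))" for \<tau> \<sigma>
  proof (rule integrable_const_bound[where B = 1])
    show "random_variable borel (\<lambda>\<omega>. \<phi> \<tau> \<sigma> (x \<omega>))"
      unfolding x_def by (rule \<phi>_meas) (rule X)
  qed (use sw_bounds in \<open>auto simp: \<phi>_def indicator_def\<close>)

  have \<phi>_cong: "\<phi> \<tau> \<sigma> u = \<phi> \<tau> \<sigma> v" if "\<And>i. i \<in> {1..n} \<Longrightarrow> u i = v i" for \<tau> \<sigma> u v
    using sort_weight_cong[OF that] order_stat_cong[OF that] by (simp add: \<phi>_def Z_def)
  \<comment> \<open>\<open>Z \<sigma>\<close> is symmetric, and \<open>id\<close> sorts
    \<open>u \<circ> \<tau>\<close> exactly when \<open>\<tau>\<close> sorts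
    \<open>u\<close>.\<close>
  have \<phi>_compose: "\<phi> id \<sigma> (u \<circ> \<tau>) = \<phi> \<tau> \<sigma> u" if "\<tau> \<in> P" for \<tau> \<sigma> u
  proof -
    have "Z \<sigma> (u \<circ> \<tau>) = Z \<sigma> u"
      unfolding Z_def using that by (intro sum.cong refl) (auto simp: P_def order_stat_compose)
    then show ?thesis using that by (simp add: \<phi>_def P_def sort_weight_compose)
  qed

  have D: "distr M borel (X i) = density lborel (\<lambda>t. ennreal (f t))" if "i \<in> {1..n}" for i
    using distributed_distr_eq_density[OF assms(8)[OF that]] by (simp cong: distr_cong)
  have exch: "expectation (\<lambda>\<omega>. \<phi> \<tau> \<sigma> (x \<omega>)) = expectation (\<lambda>\<omega>. \<phi> id \<sigma> (x \<omega>))" if \<tau>: "\<tau> \<in> P" for \<tau> \<sigma>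
  proof -
    \<comment> \<open>\<open>\<phi> \<pi> \<sigma>\<close> is \<open>\<phi> id \<sigma>\<close> at
      the vector permuted by \<open>\<pi>\<close>. By exchangeability the law of that vector is the
      same for \<open>\<tau>\<close> and for \<open>id\<close>.\<close>
    have push: "(\<integral>u. \<phi> id \<sigma> u \<partial>distr M ?N (\<lambda>\<omega>. \<lambda>i\<in>{1..n}. X (\<pi> i) \<omega>)) =
        expectation (\<lambda>\<omega>. \<phi> \<pi> \<sigma> (x \<omega>))" if \<pi>: "\<pi> \<in> P" for \<pi>
    proof -
      have [measurable]: "random_variable borel (X (\<pi> i))" if "i \<in> {1..n}" for i
        using that \<pi> by (intro X) (simp only: P_def mem_Collect_eq permutes_in_image)
      have "(\<integral>u. \<phi> id \<sigma> u \<partial>distr M ?N (\<lambda>\<omega>. \<lambda>i\<in>{1..n}. X (\<pi> i) \<omega>)) =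
          expectation (\<lambda>\<omega>. \<phi> id \<sigma> (\<lambda>i\<in>{1..n}. X (\<pi> i) \<omega>))"
        by (intro integral_distr \<phi>_meas[of "\<lambda>i u. u i"]) auto
      also have "\<dots> = expectation (\<lambda>\<omega>. \<phi> id \<sigma> (x \<omega> \<circ> \<pi>))"
        by (intro Bochner_Integration.integral_cong refl \<phi>_cong) (simp add: x_def)
      finally show ?thesis by (simp add: \<phi>_compose \<pi>)
    qed
    have "distr M ?N (\<lambda>\<omega>. \<lambda>i\<in>{1..n}. X (\<tau> i) \<omega>) = distr M ?N (\<lambda>\<omega>. \<lambda>i\<in>{1..n}. X (id i) \<omega>)"
      using iid_exchangeable[OF assms(4) _ _ D] assms(1) \<tau> by (simp add: P_def)
    then show ?thesis
      using push[OF \<tau>] push[of id] by (simp add: P_def permutes_id)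
  qed

  have F_\<sigma>: "cdf (distr M borel (\<lambda>\<omega>. Z \<sigma> (x \<omega>))) y = fact n * expectation (\<lambda>\<omega>. \<phi> id \<sigma> (x \<omega>))" for \<sigma>
  proof -
    \<comment> \<open>A decomposition with a constant family. Its \<open>n!\<close> summands have
      equal expectations by \<open>exch\<close>.\<close>
    have "indicator {..y} (Z \<sigma> u) = (\<Sum>\<tau>\<in>P. \<phi> \<tau> \<sigma> u)" for u
      unfolding \<phi>_def P_def by (rule sort_weight_decompose) simp
    then have "cdf (distr M borel (\<lambda>\<omega>. Z \<sigma> (x \<omega>))) y = (\<Sum>\<tau>\<in>P. expectation (\<lambda>\<omega>. \<phi> \<tau> \<sigma> (x \<omega>)))"
      by (simp add: cdf_distr_eq_expectation[OF ZX_meas] \<phi>_int)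
    also have "\<dots> = (\<Sum>\<tau>\<in>P. expectation (\<lambda>\<omega>. \<phi> id \<sigma> (x \<omega>)))"
      by (intro sum.cong refl exch)
    finally show ?thesis
      by (simp add: P_def card_permutations)
  qed

  \<comment> \<open>Here the family varies with \<open>\<tau>\<close>: if \<open>\<tau>\<close>
    sorts \<open>u\<close>, the Choquet integral is \<open>Z \<tau> u\<close>, so exactly the
    diagonal terms occur.\<close>
  have "indicator {..y} (choquet n \<nu> u) = (\<Sum>\<tau>\<in>P. \<phi> \<tau> \<tau> u)" for u
    unfolding \<phi>_def P_def
  proof (rule sort_weight_decompose)
    fix \<tau> assume \<tau>: "sorting_perm n u \<tau>"
    have "Z \<tau> u = choquet n \<nu> u"
      unfolding Z_def choquet_eq[where \<nu> = \<nu>, OF \<nu>0 \<tau>]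
      by (intro sum.cong refl) (simp add: sorting_perm_order_stat[OF \<tau>])
    then show "indicator {..y} (Z \<tau> u) = (indicator {..y} (choquet n \<nu> u) :: real)" by simp
  qed
  moreover have "random_variable borel (\<lambda>\<omega>. choquet n \<nu> (x \<omega>))"
    unfolding x_def by (rule borel_measurable_choquet) (use X \<nu>0 in auto)
  ultimately have "cdf (distr M borel (\<lambda>\<omega>. choquet n \<nu> (x \<omega>))) y =
      (\<Sum>\<tau>\<in>P. expectation (\<lambda>\<omega>. \<phi> \<tau> \<tau> (x \<omega>)))"
    by (simp add: cdf_distr_eq_expectation \<phi>_int)
  \<comment> \<open>\<open>exch\<close> replaces only the first index by \<open>id\<close>;
    \<open>F_\<sigma>\<close> then reads each term as \<open>1 / n!\<close> of a distribution
    function.\<close>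
  also have "\<dots> = (\<Sum>\<sigma>\<in>P. expectation (\<lambda>\<omega>. \<phi> id \<sigma> (x \<omega>)))"
    by (intro sum.cong refl exch)
  also have "\<dots> = 1 / fact n * (\<Sum>\<sigma>\<in>P. cdf (distr M borel (\<lambda>\<omega>. Z \<sigma> (x \<omega>))) y)"
    by (simp add: F_\<sigma> sum_distrib_left)
  finally show "cdf (distr M borel (\<lambda>\<omega>. choquet n \<nu> (\<lambda>i. X i \<omega>))) y =
    1 / fact n * (\<Sum>\<sigma> | \<sigma> permutes {1..n}.
      cdf (distr M borel (\<lambda>\<omega>. \<Sum>i=1..n. chain_inc \<nu> \<sigma> i *
        order_stat n (n - i + 1) (\<lambda>i. X i \<omega>))) y)"
    by (simp add: Z_def P_def x_def)
qed

end
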